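(* Let $O:\mathcal E\to\mathcal B$ be a Grothendieck fibration and let $A:\mathcal E\to[0,\infty]$ be a functor. Whenever the right Kan extension $\operatorname{Ran}_OA$ exists, its pointwise value at $b\in\mathcal B$ is $$(\operatorname{Ran}_OA)(b)=\inf_{(u:b\to O(e))\in(b\downarrow O)}A(e)=\inf_{e\in\mathcal E_b}A(e).$$
   Context: Here $[0,\infty]$ is the poset category with its usual order, so functoriality of $A$ means $A(e)\le A(e')$ whenever there is a morphism $e\to e'$. A functor $O:\mathcal E\to\mathcal B$ is a Grothendieck fibration if for every $e\in\mathcal E$ and every $u:b'\to O(e)$ in $\mathcal B$ there is a cartesian arrow $\bar u:e'\to e$ over $u$. $\mathcal E_b$ is the strict fiber over $b$ (objects $e$ with $O(e)=b$). The comma category $(b\downarrow O)$ has objects pairs $(e,u:b\to O(e))$. $\inf\varnothing=\infty$. *)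

theory Defs
  imports "HOL-Library.Extended_Nonnegative_Real"
begin

text \<open>Composition is written in the usual order: \<open>Cmp C g f\<close> is \<open>g\<close> after \<open>f\<close>.\<close>

record ('o, 'm) cat =
  Ob :: "'o set"
  Ar :: "'m set"
  Src :: "'m \<Rightarrow> 'o"
  Tgt :: "'m \<Rightarrow> 'o"
  Idt :: "'o \<Rightarrow> 'm"
  Cmp :: "'m \<Rightarrow> 'm \<Rightarrow> 'm"

definition Hom :: "('o, 'm) cat \<Rightarrow> 'o \<Rightarrow> 'o \<Rightarrow> 'm set" where
  "Hom C a b = {f \<in> Ar C. Src C f = a \<and> Tgt C f = b}"

locale category =
  fixes C :: "('o, 'm) cat"
  assumes Src_Ob: "f \<in> Ar C \<Longrightarrow> Src C f \<in> Ob C"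
    and Tgt_Ob: "f \<in> Ar C \<Longrightarrow> Tgt C f \<in> Ob C"
    and Idt_Hom: "a \<in> Ob C \<Longrightarrow> Idt C a \<in> Hom C a a"
    and Cmp_Hom: "\<lbrakk>f \<in> Hom C a b; g \<in> Hom C b c\<rbrakk> \<Longrightarrow> Cmp C g f \<in> Hom C a c"
    and Cmp_Idt_left: "f \<in> Hom C a b \<Longrightarrow> Cmp C (Idt C b) f = f"
    and Cmp_Idt_right: "f \<in> Hom C a b \<Longrightarrow> Cmp C f (Idt C a) = f"
    and Cmp_assoc: "\<lbrakk>f \<in> Hom C a b; g \<in> Hom C b c; h \<in> Hom C c d\<rbrakk> \<Longrightarrow>
      Cmp C h (Cmp C g f) = Cmp C (Cmp C h g) f"

record ('o1, 'm1, 'o2, 'm2) fctr =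
  omap :: "'o1 \<Rightarrow> 'o2"
  amap :: "'m1 \<Rightarrow> 'm2"

locale is_functor = dom: category C + cod: category D
  for C :: "('o1, 'm1) cat" and D :: "('o2, 'm2) cat" +
  fixes F :: "('o1, 'm1, 'o2, 'm2) fctr"
  assumes omap_Ob: "a \<in> Ob C \<Longrightarrow> omap F a \<in> Ob D"
    and amap_Hom: "f \<in> Hom C a b \<Longrightarrow> amap F f \<in> Hom D (omap F a) (omap F b)"
    and amap_Idt: "a \<in> Ob C \<Longrightarrow> amap F (Idt C a) = Idt D (omap F a)"
    and amap_Cmp: "\<lbrakk>f \<in> Hom C a b; g \<in> Hom C b c\<rbrakk> \<Longrightarrow>
      amap F (Cmp C g f) = Cmp D (amap F g) (amap F f)"

definition fctr_comp ::
    "('o2, 'm2, 'o3, 'm3) fctr \<Rightarrow> ('o1, 'm1, 'o2, 'm2) fctr \<Rightarrow> ('o1, 'm1, 'o3, 'm3) fctr" where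
  "fctr_comp G F = \<lparr>omap = omap G \<circ> omap F, amap = amap G \<circ> amap F\<rparr>"

locale nat_trans = source: is_functor C D F + target: is_functor C D G
  for C :: "('o1, 'm1) cat" and D :: "('o2, 'm2) cat" and F G +
  fixes \<tau> :: "'o1 \<Rightarrow> 'm2"
  assumes component_Hom: "a \<in> Ob C \<Longrightarrow> \<tau> a \<in> Hom D (omap F a) (omap G a)"
    and naturality: "f \<in> Hom C a b \<Longrightarrow> Cmp D (\<tau> b) (amap F f) = Cmp D (amap G f) (\<tau> a)"

text \<open>\<open>(R, \<epsilon>)\<close> is a right Kan extension of \<open>A : E \<rightarrow> D\<close> along \<open>P : E \<rightarrow> B\<close>.
  Transformations are uniquely determined only on the objects of their domain category,
  since HOL functions have arbitrary values elsewhere.\<close>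

locale right_Kan_extension =
  along: is_functor E B P + extended: is_functor E D A + extension: is_functor B D R +
  counit: nat_trans E D "fctr_comp R P" A \<epsilon>
  for E :: "('oe, 'me) cat" and B :: "('ob, 'mb) cat" and D :: "('od, 'md) cat"
    and P A R \<epsilon> +
  assumes universal: "\<lbrakk>is_functor B D F; nat_trans E D (fctr_comp F P) A \<delta>\<rbrakk> \<Longrightarrow>
    \<exists>\<gamma>. (nat_trans B D F R \<gamma> \<and> (\<forall>e \<in> Ob E. Cmp D (\<epsilon> e) (\<gamma> (omap P e)) = \<delta> e)) \<and>
      (\<forall>\<gamma>'. nat_trans B D F R \<gamma>' \<and> (\<forall>e \<in> Ob E. Cmp D (\<epsilon> e) (\<gamma>' (omap P e)) = \<delta> e) \<longrightarrow>
        (\<forall>b \<in> Ob B. \<gamma>' b = \<gamma> b))"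

definition cartesian ::
    "('oe, 'me) cat \<Rightarrow> ('ob, 'mb) cat \<Rightarrow> ('oe, 'me, 'ob, 'mb) fctr \<Rightarrow> 'me \<Rightarrow> bool" where
  "cartesian E B P k \<longleftrightarrow> k \<in> Ar E \<and>
    (\<forall>e'' \<in> Ob E. \<forall>g \<in> Hom E e'' (Tgt E k).
      \<forall>w \<in> Hom B (omap P e'') (omap P (Src E k)).
        Cmp B (amap P k) w = amap P g \<longrightarrow>
        (\<exists>!h. h \<in> Hom E e'' (Src E k) \<and> amap P h = w \<and> Cmp E k h = g))"

locale Grothendieck_fibration = is_functor E B P
  for E :: "('oe, 'me) cat" and B :: "('ob, 'mb) cat" and P +
  assumes cartesian_lift: "\<lbrakk>e \<in> Ob E; b' \<in> Ob B; u \<in> Hom B b' (omap P e)\<rbrakk> \<Longrightarrow>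
    \<exists>e' \<in> Ob E. \<exists>k \<in> Hom E e' e. omap P e' = b' \<and> amap P k = u \<and> cartesian E B P k"

definition fiber ::
    "('oe, 'me) cat \<Rightarrow> ('ob, 'mb) cat \<Rightarrow> ('oe, 'me, 'ob, 'mb) fctr \<Rightarrow> 'ob \<Rightarrow> ('oe, 'me) cat" where
  "fiber E B P b = \<lparr>
    Ob = {e \<in> Ob E. omap P e = b},
    Ar = {f \<in> Ar E. omap P (Src E f) = b \<and> omap P (Tgt E f) = b \<and> amap P f = Idt B b},
    Src = Src E, Tgt = Tgt E, Idt = Idt E, Cmp = Cmp E\<rparr>"

text \<open>The comma category \<open>b \<down> P\<close>. An arrow \<open>f : (e, u) \<rightarrow> (e', u')\<close> is encoded as the
  triple \<open>((e, u), f, (e', u'))\<close>, so that it determines its source and target.\<close>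

definition comma ::
    "('oe, 'me) cat \<Rightarrow> ('ob, 'mb) cat \<Rightarrow> 'ob \<Rightarrow> ('oe, 'me, 'ob, 'mb) fctr \<Rightarrow>
      ('oe \<times> 'mb, ('oe \<times> 'mb) \<times> 'me \<times> ('oe \<times> 'mb)) cat" where
  "comma E B b P = \<lparr>
    Ob = {(e, u). e \<in> Ob E \<and> u \<in> Hom B b (omap P e)},
    Ar = {((e, u), f, (e', u')). e \<in> Ob E \<and> u \<in> Hom B b (omap P e) \<and>
      e' \<in> Ob E \<and> u' \<in> Hom B b (omap P e') \<and> f \<in> Hom E e e' \<and> Cmp B (amap P f) u = u'},
    Src = (\<lambda>(x, f, y). x), Tgt = (\<lambda>(x, f, y). y),
    Idt = (\<lambda>(e, u). ((e, u), Idt E e, (e, u))),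
    Cmp = (\<lambda>(y, g, z) (x, f, y'). (x, Cmp E g f, z))\<rparr>"

text \<open>An ordered type as a category: the arrow \<open>x \<rightarrow> y\<close>, present iff \<open>x \<le> y\<close>, is the pair
  \<open>(x, y)\<close>. The poset \<open>[0, \<infinity>]\<close> is the type \<^typ>\<open>ennreal\<close>, in which \<open>Inf {} = \<infinity>\<close>.\<close>

definition poset_cat :: "('a :: order, 'a \<times> 'a) cat" where
  "poset_cat = \<lparr>Ob = UNIV, Ar = {(x, y). x \<le> y}, Src = fst, Tgt = snd,
    Idt = (\<lambda>x. (x, x)), Cmp = (\<lambda>g f. (fst f, snd g))\<rparr>"

abbreviation ennreal_cat :: "(ennreal, ennreal \<times> ennreal) cat" where
  "ennreal_cat \<equiv> poset_cat"

lemma category_poset_cat: "category poset_cat"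
  by unfold_locales (auto simp: poset_cat_def Hom_def)

context is_functor
begin

lemma category_fiber:
  assumes "b \<in> Ob D"
  shows "category (fiber C D F b)"
proof -
  have i: "Cmp D (Idt D b) (Idt D b) = Idt D b"
    using assms cod.Cmp_Idt_left cod.Idt_Hom by blast
  have H: "f \<in> Hom (fiber C D F b) x y \<longleftrightarrow>
      f \<in> Hom C x y \<and> omap F x = b \<and> omap F y = b \<and> amap F f = Idt D b" for f x y
    by (auto simp: fiber_def Hom_def)
  show ?thesis
  proof
    fix f x y g z assume "f \<in> Hom (fiber C D F b) x y" "g \<in> Hom (fiber C D F b) y z"
    then show "Cmp (fiber C D F b) g f \<in> Hom (fiber C D F b) x z"
      unfolding H using amap_Cmp[of f x y g z] dom.Cmp_Hom[of f x y g z] i by (simp add: fiber_def)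
  next
    fix a assume "a \<in> Ob (fiber C D F b)"
    then show "Idt (fiber C D F b) a \<in> Hom (fiber C D F b) a a"
      unfolding H using dom.Idt_Hom amap_Idt by (auto simp: fiber_def)
  next
    fix f x y assume "f \<in> Hom (fiber C D F b) x y"
    then show "Cmp (fiber C D F b) (Idt (fiber C D F b) y) f = f"
      unfolding H using dom.Cmp_Idt_left[of f x y] by (simp add: fiber_def)
  next
    fix f x y assume "f \<in> Hom (fiber C D F b) x y"
    then show "Cmp (fiber C D F b) f (Idt (fiber C D F b) x) = f"
      unfolding H using dom.Cmp_Idt_right[of f x y] by (simp add: fiber_def)
  next
    fix f x y g z h w
    assume "f \<in> Hom (fiber C D F b) x y" "g \<in> Hom (fiber C D F b) y z"
      "h \<in> Hom (fiber C D F b) z w"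
    then show "Cmp (fiber C D F b) h (Cmp (fiber C D F b) g f) =
        Cmp (fiber C D F b) (Cmp (fiber C D F b) h g) f"
      unfolding H using dom.Cmp_assoc[of f x y g z h w] by (simp add: fiber_def)
  qed (auto simp: fiber_def dom.Src_Ob dom.Tgt_Ob)
qed

lemma category_comma: "category (comma C D b F)"
proof -
  have H: "m \<in> Hom (comma C D b F) x y \<longleftrightarrow> (\<exists>f. m = (x, f, y) \<and> f \<in> Hom C (fst x) (fst y) \<and>
      fst x \<in> Ob C \<and> fst y \<in> Ob C \<and> snd x \<in> Hom D b (omap F (fst x)) \<and>
      snd y \<in> Hom D b (omap F (fst y)) \<and> Cmp D (amap F f) (snd x) = snd y)" for m x y
    by (auto simp: comma_def Hom_def)
  show ?thesis
  proof
    fix m x y n z assume m: "m \<in> Hom (comma C D b F) x y" and n: "n \<in> Hom (comma C D b F) y z"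
    obtain f where f: "m = (x, f, y)" "f \<in> Hom C (fst x) (fst y)"
      "Cmp D (amap F f) (snd x) = snd y" "snd x \<in> Hom D b (omap F (fst x))"
      using m unfolding H by blast
    obtain g where g: "n = (y, g, z)" "g \<in> Hom C (fst y) (fst z)"
      "Cmp D (amap F g) (snd y) = snd z"
      using n unfolding H by blast
    have "Cmp D (amap F (Cmp C g f)) (snd x) = snd z"
      unfolding amap_Cmp[OF f(2) g(2)]
      using cod.Cmp_assoc[OF f(4) amap_Hom[OF f(2)] amap_Hom[OF g(2)]] f(3) g(3) by simp
    moreover have "Cmp (comma C D b F) n m = (x, Cmp C g f, z)"
      using f(1) g(1) by (simp add: comma_def)
    ultimately show "Cmp (comma C D b F) n m \<in> Hom (comma C D b F) x z"
      using m n dom.Cmp_Hom[OF f(2) g(2)] unfolding H by blast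
  next
    fix a assume "a \<in> Ob (comma C D b F)"
    then show "Idt (comma C D b F) a \<in> Hom (comma C D b F) a a"
      unfolding H using dom.Idt_Hom amap_Idt cod.Cmp_Idt_left by (auto simp: comma_def)
  next
    fix f x y assume "f \<in> Hom (comma C D b F) x y"
    then show "Cmp (comma C D b F) (Idt (comma C D b F) y) f = f"
      unfolding H using dom.Cmp_Idt_left by (auto simp: comma_def split: prod.splits)
  next
    fix f x y assume "f \<in> Hom (comma C D b F) x y"
    then show "Cmp (comma C D b F) f (Idt (comma C D b F) x) = f"
      unfolding H using dom.Cmp_Idt_right by (auto simp: comma_def split: prod.splits)
  next
    fix f x y g z h w
    assume "f \<in> Hom (comma C D b F) x y" "g \<in> Hom (comma C D b F) y z"
      "h \<in> Hom (comma C D b F) z w"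
    then show "Cmp (comma C D b F) h (Cmp (comma C D b F) g f) =
        Cmp (comma C D b F) (Cmp (comma C D b F) h g) f"
      unfolding H using dom.Cmp_assoc by (auto simp: comma_def)
  qed (auto simp: comma_def)
qed

end

end

theory Submission
  imports Defs
begin

text \<open>
  In a poset category a right Kan extension along \<open>P\<close> is the greatest monotone map \<open>R\<close> on the
  base with \<open>R (P e) \<le> A e\<close> for all \<open>e\<close>. In a complete lattice such a map can be written down:
  \<open>b\<close> goes to the infimum of \<open>A\<close> over the comma category \<open>b \<down> P\<close>. It is monotone because
  precomposing with \<open>b \<rightarrow> b'\<close> sends objects of \<open>b' \<down> P\<close> to objects of \<open>b \<down> P\<close> with the same \<open>A\<close>,
  and it lies below \<open>A\<close> because of the objects \<open>(e, id)\<close> of \<open>P e \<down> P\<close>. It is the greatest such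
  map because an arrow \<open>u : b \<rightarrow> P e\<close> forces \<open>R b \<le> R (P e) \<le> A e\<close>. This is lemma
  \<open>right_Kan_extension_eq_INF_comma\<close>.

  The fibration allows replacing the comma category by the fiber. The fiber over \<open>b\<close>
  embeds into \<open>b \<down> P\<close> by \<open>e \<mapsto> (e, id)\<close>. Conversely, lifting \<open>u : b \<rightarrow> P e\<close> gives an
  arrow \<open>e' \<rightarrow> e\<close> with \<open>e'\<close> over \<open>b\<close>, so \<open>A e' \<le> A e\<close> by monotonicity, and the infimum over the
  fiber is no larger. This is lemma \<open>INF_comma_eq_INF_fiber\<close>.
\<close>

lemma Ob_poset_cat [simp]: "Ob poset_cat = UNIV"
  by (simp add: poset_cat_def)

lemma Hom_poset_cat: "m \<in> Hom poset_cat x y \<longleftrightarrow> m = (x, y) \<and> x \<le> y"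
  by (cases m) (auto simp: Hom_def poset_cat_def)

lemma Cmp_poset_cat: "Cmp poset_cat g f = (fst f, snd g)"
  by (simp add: poset_cat_def)

lemma omap_le_if_Hom:
  assumes "is_functor C poset_cat F" and "f \<in> Hom C x y"
  shows "omap F x \<le> omap F y"
  using is_functor.amap_Hom[OF assms] by (simp add: Hom_poset_cat)

lemma nat_trans_poset_le:
  assumes "nat_trans C poset_cat F G \<tau>" and "a \<in> Ob C"
  shows "omap F a \<le> omap G a"
  using nat_trans.component_Hom[OF assms] by (simp add: Hom_poset_cat)

lemma omap_fctr_comp [simp]: "omap (fctr_comp G F) x = omap G (omap F x)"
  by (simp add: fctr_comp_def)

lemma is_functor_fctr_comp:
  assumes "is_functor C D F" and "is_functor D E G"
  shows "is_functor C E (fctr_comp G F)"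
proof -
  interpret F: is_functor C D F by fact
  interpret G: is_functor D E G by fact
  show ?thesis
    by unfold_locales
      (auto simp: fctr_comp_def F.omap_Ob G.omap_Ob F.amap_Idt G.amap_Idt F.amap_Cmp
        intro: F.amap_Hom G.amap_Hom G.amap_Cmp[OF F.amap_Hom F.amap_Hom])
qed

definition poset_fctr ::
    "('o, 'm) cat \<Rightarrow> ('o \<Rightarrow> 'a) \<Rightarrow> ('o, 'm, 'a :: order, 'a \<times> 'a) fctr" where
  "poset_fctr C f = \<lparr>omap = f, amap = (\<lambda>m. (f (Src C m), f (Tgt C m)))\<rparr>"

lemma omap_poset_fctr [simp]: "omap (poset_fctr C f) = f"
  by (simp add: poset_fctr_def)

lemma is_functor_poset_fctr:
  fixes C :: "('o, 'm) cat" and f :: "'o \<Rightarrow> 'a :: order"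
  assumes "category C" and mono: "\<And>m x y. m \<in> Hom C x y \<Longrightarrow> f x \<le> f y"
  shows "is_functor C poset_cat (poset_fctr C f)"
proof -
  interpret C: category C by fact
  interpret P: category "poset_cat :: ('a, 'a \<times> 'a) cat" by (rule category_poset_cat)
  have ends: "Src C m = x \<and> Tgt C m = y" if "m \<in> Hom C x y" for m x y
    using that by (simp add: Hom_def)
  show ?thesis
  proof
    fix m x y assume "m \<in> Hom C x y"
    then show "amap (poset_fctr C f) m
        \<in> Hom poset_cat (omap (poset_fctr C f) x) (omap (poset_fctr C f) y)"
      using mono ends by (simp add: Hom_poset_cat poset_fctr_def)
  next
    fix a assume "a \<in> Ob C"
    then show "amap (poset_fctr C f) (Idt C a) = Idt poset_cat (omap (poset_fctr C f) a)"
      using ends[OF C.Idt_Hom] by (simp add: poset_fctr_def poset_cat_def)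
  next
    fix m n x y z assume "m \<in> Hom C x y" "n \<in> Hom C y z"
    then show "amap (poset_fctr C f) (Cmp C n m)
        = Cmp poset_cat (amap (poset_fctr C f) n) (amap (poset_fctr C f) m)"
      using ends C.Cmp_Hom[of m x y n z] by (simp add: poset_fctr_def Cmp_poset_cat)
  qed simp
qed

text \<open>Naturality is automatic: two arrows of a poset category with the same ends are equal.\<close>

lemma nat_trans_posetI:
  assumes F: "is_functor C poset_cat F" and G: "is_functor C poset_cat G"
    and le: "\<And>a. a \<in> Ob C \<Longrightarrow> omap F a \<le> omap G a"
  shows "nat_trans C poset_cat F G (\<lambda>a. (omap F a, omap G a))"
proof -
  interpret F: is_functor C poset_cat F by fact
  interpret G: is_functor C poset_cat G by fact
  show ?thesis
  proof
    fix f a b assume f: "f \<in> Hom C a b"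
    show "Cmp poset_cat (omap F b, omap G b) (amap F f)
        = Cmp poset_cat (amap G f) (omap F a, omap G a)"
      using F.amap_Hom[OF f] G.amap_Hom[OF f] by (simp add: Hom_poset_cat Cmp_poset_cat)
  qed (simp add: Hom_poset_cat le)
qed

lemma comma_ObI: "\<lbrakk>e \<in> Ob E; u \<in> Hom B b (omap P e)\<rbrakk> \<Longrightarrow> (e, u) \<in> Ob (comma E B b P)"
  by (simp add: comma_def)

lemma comma_ObE:
  assumes "p \<in> Ob (comma E B b P)"
  obtains e u where "p = (e, u)" "e \<in> Ob E" "u \<in> Hom B b (omap P e)"
  using assms by (auto simp: comma_def)

lemma (in is_functor) identity_comma_Ob:
  assumes "e \<in> Ob C"
  shows "(e, Idt D (omap F e)) \<in> Ob (comma C D (omap F e) F)"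
  using assms by (intro comma_ObI cod.Idt_Hom omap_Ob)

text \<open>The candidate for the Kan extension, \<open>b \<mapsto> INF\<close> over \<open>b \<down> P\<close>, respects arrows:
  the infimum over \<open>x \<down> P\<close> runs over at least the values occurring for \<open>y \<down> P\<close>.\<close>

lemma INF_comma_mono:
  fixes f :: "'oe \<Rightarrow> 'a :: complete_lattice"
  assumes "category B" and m: "m \<in> Hom B x y"
  shows "(INF (e, u) \<in> Ob (comma E B x P). f e) \<le> (INF (e, u) \<in> Ob (comma E B y P). f e)"
proof (rule INF_mono)
  fix p assume "p \<in> Ob (comma E B y P)"
  then obtain e u where p: "p = (e, u)" and e: "e \<in> Ob E" and u: "u \<in> Hom B y (omap P e)"
    by (rule comma_ObE)
  have "(e, Cmp B u m) \<in> Ob (comma E B x P)"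
    using e category.Cmp_Hom[OF \<open>category B\<close> m u] by (rule comma_ObI)
  then show "\<exists>q \<in> Ob (comma E B x P). (case q of (e, u) \<Rightarrow> f e) \<le> (case p of (e, u) \<Rightarrow> f e)"
    unfolding p by (rule bexI[rotated]) simp
qed

text \<open>The pointwise formula: the infimum is a lower bound of \<open>A\<close> along \<open>P\<close>, hence below the
  universal one; and the universal one is below each \<open>A e\<close> with \<open>b \<rightarrow> P e\<close>.\<close>

lemma right_Kan_extension_eq_INF_comma:
  fixes A :: "('oe, 'me, 'a :: complete_lattice, 'a \<times> 'a) fctr"
  assumes "right_Kan_extension E B poset_cat P A R \<epsilon>" and b: "b \<in> Ob B"
  shows "omap R b = (INF (e, u) \<in> Ob (comma E B b P). omap A e)"
proof (rule antisym)
  interpret right_Kan_extension E B poset_cat P A R \<epsilon> by fact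
  show "omap R b \<le> (INF (e, u) \<in> Ob (comma E B b P). omap A e)"
  proof (rule INF_greatest)
    fix p assume "p \<in> Ob (comma E B b P)"
    then obtain e u where p: "p = (e, u)" and e: "e \<in> Ob E" and u: "u \<in> Hom B b (omap P e)"
      by (rule comma_ObE)
    have "omap R b \<le> omap R (omap P e)"
      using extension.is_functor_axioms u by (rule omap_le_if_Hom)
    also have "\<dots> \<le> omap A e"
      using nat_trans_poset_le[OF counit.nat_trans_axioms e] by simp
    finally show "omap R b \<le> (case p of (e, u) \<Rightarrow> omap A e)"
      by (simp add: p)
  qed

  define F where "F = poset_fctr B (\<lambda>b. INF (e, u) \<in> Ob (comma E B b P). omap A e)"
  have F: "is_functor B poset_cat F"
    unfolding F_def
    by (intro is_functor_poset_fctr INF_comma_mono along.cod.category_axioms)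
  have "omap F (omap P e) \<le> omap A e" if "e \<in> Ob E" for e
    using INF_lower[OF along.identity_comma_Ob[OF that], of "\<lambda>(e, u). omap A e"]
    by (simp add: F_def)
  then have "nat_trans E poset_cat (fctr_comp F P) A
      (\<lambda>e. (omap (fctr_comp F P) e, omap A e))"
    by (intro nat_trans_posetI is_functor_fctr_comp[OF along.is_functor_axioms F]
        extended.is_functor_axioms) simp
  then obtain \<gamma> where "nat_trans B poset_cat F R \<gamma>"
    using universal[OF F] by blast
  then have "omap F b \<le> omap R b"
    using b by (rule nat_trans_poset_le)
  then show "(INF (e, u) \<in> Ob (comma E B b P). omap A e) \<le> omap R b"
    by (simp add: F_def)
qed

text \<open>The values of \<open>A\<close> on the fiber are among those on \<open>b \<down> P\<close>, and each value \<open>A e\<close> on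
  \<open>b \<down> P\<close> bounds the value at the source of a lift of \<open>u : b \<rightarrow> P e\<close>, an object of the fiber.\<close>

lemma INF_comma_eq_INF_fiber:
  fixes A :: "('oe, 'me, 'a :: complete_lattice, 'a \<times> 'a) fctr"
  assumes "Grothendieck_fibration E B P" and A: "is_functor E poset_cat A" and b: "b \<in> Ob B"
  shows "(INF (e, u) \<in> Ob (comma E B b P). omap A e) = (INF e \<in> Ob (fiber E B P b). omap A e)"
proof (rule antisym)
  interpret Grothendieck_fibration E B P by fact
  show "(INF (e, u) \<in> Ob (comma E B b P). omap A e) \<le> (INF e \<in> Ob (fiber E B P b). omap A e)"
  proof (rule INF_mono)
    fix e assume "e \<in> Ob (fiber E B P b)"
    then have "(e, Idt B b) \<in> Ob (comma E B b P)"
      using identity_comma_Ob by (auto simp: fiber_def)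
    then show "\<exists>p \<in> Ob (comma E B b P). (case p of (e, u) \<Rightarrow> omap A e) \<le> omap A e"
      by (rule bexI[rotated]) simp
  qed
  show "(INF e \<in> Ob (fiber E B P b). omap A e) \<le> (INF (e, u) \<in> Ob (comma E B b P). omap A e)"
  proof (rule INF_mono)
    fix p assume "p \<in> Ob (comma E B b P)"
    then obtain e u where p: "p = (e, u)" and e: "e \<in> Ob E" and u: "u \<in> Hom B b (omap P e)"
      by (rule comma_ObE)
    obtain e' k where e': "e' \<in> Ob E" "omap P e' = b" and k: "k \<in> Hom E e' e"
      using cartesian_lift[OF e b u] by blast
    have "e' \<in> Ob (fiber E B P b)"
      using e' by (simp add: fiber_def)
    moreover have "omap A e' \<le> (case p of (e, u) \<Rightarrow> omap A e)"
      using omap_le_if_Hom[OF A k] by (simp add: p)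
    ultimately show "\<exists>e \<in> Ob (fiber E B P b). omap A e \<le> (case p of (e, u) \<Rightarrow> omap A e)"
      by blast
  qed
qed

theorem proposition28p4:
  fixes \<E> :: "('oe, 'me) cat" and \<B> :: "('ob, 'mb) cat"
    and \<O> :: "('oe, 'me, 'ob, 'mb) fctr"
    and A :: "('oe, 'me, ennreal, ennreal \<times> ennreal) fctr"
    and Ran :: "('ob, 'mb, ennreal, ennreal \<times> ennreal) fctr"
    and \<epsilon> :: "'oe \<Rightarrow> ennreal \<times> ennreal" and b :: 'ob
  assumes "Grothendieck_fibration \<E> \<B> \<O>"
    and "is_functor \<E> ennreal_cat A"
    and "right_Kan_extension \<E> \<B> ennreal_cat \<O> A Ran \<epsilon>"
    and "b \<in> Ob \<B>"
  shows "omap Ran b = (INF (e, u) \<in> Ob (comma \<E> \<B> b \<O>). omap A e) \<and>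
    (INF (e, u) \<in> Ob (comma \<E> \<B> b \<O>). omap A e) = (INF e \<in> Ob (fiber \<E> \<B> \<O> b). omap A e)"
  using right_Kan_extension_eq_INF_comma[OF assms(3,4)]
    INF_comma_eq_INF_fiber[OF assms(1,2,4)]
  by blast

end
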